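(* Let $q$ be a power of $2$. For every odd integer $n>1$, one has $$\mathcal U_n(B,C),\ \Lambda_n(B,C)\in\mathbb F_q[B^2,C].$$
   Context: Let $B,C$ be algebraically independent indeterminates over $\mathbb F_q$. The Lucas polynomials of the first type are $\mathcal U_0=0$, $\mathcal U_1=1$, $\mathcal U_n=-B\,\mathcal U_{n-1}-C\,\mathcal U_{n-2}$ for $n\ge2$. Lucas atoms: let $\alpha,\beta$ be the two roots of $T^2+BT+C$ in an algebraic closure of $\mathbb F_q(B,C)$. Let $\Phi_n(X)\in\mathbb F_q[X]$ be the $n$-th cyclotomic polynomial (the image of the integral one), $\varphi$ Euler's totient function, and $\Phi_n^{\mathrm{hom}}(\alpha,\beta)=\beta^{\varphi(n)}\Phi_n(\alpha/\beta)$. For $n\ge2$ the $n$-th Lucas atom $\Lambda_n(B,C)\in\mathbb F_q[B,C]$ is the unique polynomial with $\Lambda_n(B,C)=\Phi_n^{\mathrm{hom}}(\alpha,\beta)$. *)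

theory Defs
  imports
    Complex_Main
    "HOL-Computational_Algebra.Polynomial_Factorial"
    "HOL-Number_Theory.Totient"
    "HOL-Algebra.Algebraic_Closure_Type"
begin

text \<open>
  The two-variable polynomial ring \<open>F[B,C]\<close> is represented as \<open>'a poly poly\<close>, that is, as
  \<open>F[C][B]\<close>: the outer variable is \<open>B\<close> and the coefficients are polynomials in \<open>C\<close>.
\<close>

definition const_BC :: "'a \<Rightarrow> 'a::field poly poly" where
  "const_BC c = [:[:c:]:]"

definition var_B :: "'a::field poly poly" where
  "var_B = [:0, 1:]"

definition var_C :: "'a::field poly poly" where
  "var_C = [:[:0, 1:]:]"

inductive_set subalgebra_gen :: "'a::field poly poly set \<Rightarrow> 'a poly poly set"
  for S :: "'a poly poly set" where
  const: "const_BC c \<in> subalgebra_gen S"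
| gen: "x \<in> S \<Longrightarrow> x \<in> subalgebra_gen S"
| add: "x \<in> subalgebra_gen S \<Longrightarrow> y \<in> subalgebra_gen S \<Longrightarrow> x + y \<in> subalgebra_gen S"
| mult: "x \<in> subalgebra_gen S \<Longrightarrow> y \<in> subalgebra_gen S \<Longrightarrow> x * y \<in> subalgebra_gen S"

fun lucas_U :: "nat \<Rightarrow> 'a::field poly poly" where
  "lucas_U 0 = 0"
| "lucas_U (Suc 0) = 1"
| "lucas_U (Suc (Suc n)) = - var_B * lucas_U (Suc n) - var_C * lucas_U n"

definition cyclotomic_complex :: "nat \<Rightarrow> complex poly" where
  "cyclotomic_complex n =
     (\<Prod>k\<in>totatives n. [:- cis (2 * pi * real k / real n), 1:])"

definition cyclotomic_int :: "nat \<Rightarrow> int poly" where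
  "cyclotomic_int n = (THE P. map_poly of_int P = cyclotomic_complex n)"

definition cyclotomic :: "nat \<Rightarrow> 'a::field poly" where
  "cyclotomic n = map_poly of_int (cyclotomic_int n)"

type_synonym 'a BC_closure = "'a poly poly fract alg_closure"

definition embed_BC :: "'a::field poly poly \<Rightarrow> 'a BC_closure" where
  "embed_BC p = to_ac (to_fract p)"

text \<open>
  The homogenisation \<open>\<beta>\<^sup>d \<Phi>\<^sub>n(\<alpha>/\<beta>)\<close> with \<open>d = totient n\<close>, where \<open>\<Phi>\<^sub>n\<close> is taken over \<open>F\<close> and its
  coefficients are then mapped into the algebraic closure of \<open>F(B,C)\<close>.
\<close>

definition cyclotomic_hom ::
    "nat \<Rightarrow> 'a::field BC_closure \<Rightarrow> 'a BC_closure \<Rightarrow> 'a BC_closure" where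
  "cyclotomic_hom n \<alpha> \<beta> =
     \<beta> ^ totient n * poly (map_poly (\<lambda>c. embed_BC (const_BC c)) (cyclotomic n :: 'a poly)) (\<alpha> / \<beta>)"

text \<open>
  The factorisation below says that \<open>\<alpha>\<close>, \<open>\<beta>\<close> are the two roots of \<open>T\<^sup>2 + B T + C\<close>, in either
  order. The value is only meaningful for \<open>n \<ge> 2\<close>, where \<open>cyclotomic_hom n\<close> is symmetric
  in \<open>\<alpha>\<close> and \<open>\<beta>\<close>.
\<close>

definition lucas_atom :: "nat \<Rightarrow> 'a::field poly poly" where
  "lucas_atom n = (THE L. \<forall>\<alpha> \<beta>.
     [:embed_BC var_C, embed_BC var_B, 1:] = [:- \<alpha>, 1:] * [:- \<beta>, 1:] \<longrightarrow>
     embed_BC L = cyclotomic_hom n \<alpha> \<beta>)"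

end

(*
  The homogenised cyclotomic polynomial is palindromic of even degree 2 m for n > 2. Pairing its
  terms of index i and 2 m - i and using \<alpha> \<beta> = C writes it as c_m C^m plus a combination of
  the C^i (\<alpha>^(2 (m - i)) + \<beta>^(2 (m - i))). The even power
  sums satisfy a recurrence with coefficients B^2 - 2 C and - C^2, hence lie in F[B^2, C].
*)
theory Submission
  imports Defs "HOL-Computational_Algebra.Fundamental_Theorem_Algebra"
begin

section \<open>Factorisation of X^n - 1 over the complex numbers\<close>

section \<open>Cyclotomic polynomials\<close>

text \<open>The derivative n X^(n-1) can vanish only at 0, which is not a root, so X^n - 1 is
  squarefree and splits into distinct linear factors.\<close>

lemma prod_roots_of_unity:
  assumes "n > 0"
  shows "(\<Prod>k\<in>{0<..n}. [:- cis (2 * pi * real k / real n), 1:]) = monom 1 n - (1 :: complex poly)"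
proof -
  let ?p = "monom 1 n - (1 :: complex poly)"
  have roots: "{z. poly ?p z = 0} = {z. z ^ n = 1}"
    by (auto simp: poly_monom)
  have "degree (1 :: complex poly) < degree (monom (1 :: complex) n)"
    using assms by (simp add: degree_monom_eq)
  hence lead: "lead_coeff ?p = 1"
    by (metis add.commute add_uminus_conv_diff degree_minus lead_coeff_add_le lead_coeff_monom)
  have "rsquarefree ?p"
    unfolding rsquarefree_roots
    using assms by (auto simp: poly_monom pderiv_diff pderiv_monom power_0_left)
  from complex_poly_decompose_rsquarefree[OF this]
  have "?p = (\<Prod>z | z ^ n = 1. [:- z, 1:])"
    unfolding roots lead by simp
  also have "\<dots> = (\<Prod>k\<in>{..<n}. [:- cis (2 * pi * real k / real n), 1:])"
    by (rule prod.reindex_bij_betw[OF bij_betw_roots_unity[OF assms], symmetric])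
  \<comment> \<open>Indices 0 and n give the same root 1. Trading one for the other yields the range
    {0<..n}, on which the indices can be sorted by their gcd with n.\<close>
  also have "{..<n} = insert 0 {0<..<n}"
    using assms by auto
  also have "(\<Prod>k\<in>insert 0 {0<..<n}. [:- cis (2 * pi * real k / real n), 1:]) =
             (\<Prod>k\<in>insert n {0<..<n}. [:- cis (2 * pi * real k / real n), 1:])"
    using assms by simp
  also have "insert n {0<..<n} = {0<..n}"
    using assms by auto
  finally show ?thesis by simp
qed

text \<open>Sort the n-th roots of unity by d = gcd k n. The class of d consists of k = j d with j a
  totative of n div d, and k / n = j / (n div d), so the class contributes
  \<open>cyclotomic_complex (n div d)\<close>.\<close>

lemma prod_cyclotomic_complex:
  assumes "n > 0"
  shows "(\<Prod>d | d dvd n. cyclotomic_complex d) = monom 1 n - 1"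
proof -
  define f where "f = (\<lambda>k. [:- cis (2 * pi * real k / real n), 1:])"
  define A where "A = (\<lambda>d. {k\<in>{0<..n}. gcd k n = d})"
  have A: "prod f (A d) = cyclotomic_complex (n div d)" if d: "d dvd n" for d
  proof -
    have "prod f (A d) = (\<Prod>k\<in>totatives (n div d). f (k * d))"
      unfolding A_def
      by (rule prod.reindex_bij_betw[OF bij_betw_totatives_gcd_eq[OF d assms], symmetric])
    also have "\<dots> = cyclotomic_complex (n div d)"
      unfolding cyclotomic_complex_def f_def using d assms
      by (intro prod.cong refl) (auto simp: real_of_nat_div field_simps elim!: dvdE)
    finally show ?thesis .
  qed
  have "monom 1 n - 1 = prod f {0<..n}"
    unfolding f_def using prod_roots_of_unity[OF assms] by simp
  also have "{0<..n} = (\<Union>d\<in>{d. d dvd n}. A d)"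
    by (auto simp: A_def)
  also have "prod f \<dots> = (\<Prod>d | d dvd n. prod f (A d))"
    using assms by (intro prod.UNION_disjoint) (auto simp: A_def)
  also have "\<dots> = (\<Prod>d | d dvd n. cyclotomic_complex (n div d))"
    by (intro prod.cong refl A) auto
  also have "\<dots> = (\<Prod>d | d dvd n. cyclotomic_complex d)"
    using assms by (intro prod.reindex_bij_witness[of _ "(div) n" "(div) n"]) (auto elim: dvdE)
  finally show ?thesis ..
qed

section \<open>Integrality of the cyclotomic polynomials\<close>

lemma coeff_mult_Ints:
  assumes "\<And>i. coeff p i \<in> \<int>" "\<And>i. coeff q i \<in> \<int>"
  shows "coeff (p * q) i \<in> \<int>"
  unfolding coeff_mult using assms by (intro Ints_sum Ints_mult)

lemma coeff_prod_Ints: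
  assumes "\<And>x i. x \<in> A \<Longrightarrow> coeff (f x) i \<in> \<int>"
  shows "coeff (\<Prod>x\<in>A. f x) i \<in> \<int>"
  using assms
proof (induction A arbitrary: i rule: infinite_finite_induct)
  case (insert x A)
  then show ?case by (simp add: coeff_mult_Ints)
qed (auto simp: coeff_1)

text \<open>The quotient is computed upwards from the constant term, as for power series.\<close>

lemma coeff_Ints_cancel:
  fixes p q :: "'a :: comm_ring_1 poly"
  assumes p: "\<And>i. coeff p i \<in> \<int>" and unit: "coeff p 0 ^ 2 = 1"
    and pq: "\<And>i. coeff (p * q) i \<in> \<int>"
  shows "coeff q i \<in> \<int>"
proof (induction i rule: less_induct)
  case (less k)
  have "coeff (p * q) k = coeff p 0 * coeff q k + (\<Sum>i\<in>{0<..k}. coeff p i * coeff q (k - i))"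
  proof -
    have "{..k} = insert 0 {0<..k}" by auto
    thus ?thesis by (simp add: coeff_mult)
  qed
  moreover have "(\<Sum>i\<in>{0<..k}. coeff p i * coeff q (k - i)) \<in> \<int>"
    by (intro Ints_sum Ints_mult p less.IH) auto
  ultimately have "coeff p 0 * coeff q k \<in> \<int>"
    using pq[of k] by (metis Ints_diff add_diff_cancel_right')
  \<comment> \<open>The constant term is its own inverse, so multiplying by it once more isolates
    \<open>coeff q k\<close>.\<close>
  hence "coeff p 0 * (coeff p 0 * coeff q k) \<in> \<int>"
    by (rule Ints_mult[OF p])
  moreover have "coeff p 0 * (coeff p 0 * coeff q k) = coeff q k"
    using unit by (simp add: power2_eq_square flip: mult.assoc)
  ultimately show ?case by simp
qed

text \<open>Strong induction over X^n - 1 = P * \<open>cyclotomic_complex n\<close>, where P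
  collects the proper divisors. Dividing by P stays integral because its constant term squares to 1;
  this is why the constant term is carried along in the induction.\<close>

lemma cyclotomic_complex_Ints:
  assumes "n > 0"
  shows "coeff (cyclotomic_complex n) i \<in> \<int>" "coeff (cyclotomic_complex n) 0 ^ 2 = 1"
proof -
  have "(\<forall>i. coeff (cyclotomic_complex n) i \<in> \<int>) \<and> coeff (cyclotomic_complex n) 0 ^ 2 = 1"
    using assms
  proof (induction n rule: less_induct)
    case (less n)
    define D where "D = {d. d dvd n} - {n}"
    define P where "P = (\<Prod>d\<in>D. cyclotomic_complex d)"
    have fin: "finite {d. d dvd n}" using less.prems by simp
    have IH: "(\<forall>i. coeff (cyclotomic_complex d) i \<in> \<int>) \<and> coeff (cyclotomic_complex d) 0 ^ 2 = 1"
      if "d \<in> D" for d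
    proof (rule less.IH)
      show "d < n" using that less.prems by (auto simp: D_def dest: dvd_imp_le)
      show "d > 0" using that less.prems by (auto simp: D_def intro: Nat.gr0I)
    qed
    have PQ: "P * cyclotomic_complex n = monom 1 n - 1"
      unfolding prod_cyclotomic_complex[OF less.prems, symmetric] P_def D_def
      using prod.remove[of "{d. d dvd n}" n cyclotomic_complex] fin by (simp add: mult.commute)
    have P: "coeff P i \<in> \<int>" for i
      unfolding P_def using IH by (intro coeff_prod_Ints) auto
    have "coeff P 0 = (\<Prod>d\<in>D. coeff (cyclotomic_complex d) 0)"
      unfolding P_def by (simp flip: poly_0_coeff_0 add: poly_prod)
    hence P0: "coeff P 0 ^ 2 = 1"
      using IH by (simp add: prod_power_distrib prod.neutral)
    have "coeff (P * cyclotomic_complex n) i \<in> \<int>" for i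
      unfolding PQ by (simp add: coeff_1)
    from coeff_Ints_cancel[OF P P0 this] have "\<forall>i. coeff (cyclotomic_complex n) i \<in> \<int>" ..
    moreover have "coeff P 0 * coeff (cyclotomic_complex n) 0 = -1"
      using less.prems by (simp add: PQ flip: coeff_mult_0)
    hence "(coeff P 0 * coeff (cyclotomic_complex n) 0) ^ 2 = 1"
      by simp
    hence "coeff (cyclotomic_complex n) 0 ^ 2 = 1"
      by (simp add: power_mult_distrib P0)
    ultimately show ?case by blast
  qed
  thus "coeff (cyclotomic_complex n) i \<in> \<int>" "coeff (cyclotomic_complex n) 0 ^ 2 = 1"
    by auto
qed

text \<open>This makes the \<open>THE\<close> in \<open>cyclotomic_int\<close> meaningful: a
  preimage exists by integrality and is unique because \<open>of_int\<close> is injective. The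
  witness applies the floor of the real part to each coefficient, which undoes
  \<open>of_int\<close>.\<close>

lemma map_poly_cyclotomic_int:
  assumes "n > 0"
  shows "map_poly of_int (cyclotomic_int n) = cyclotomic_complex n"
  unfolding cyclotomic_int_def
proof (rule theI)
  have "complex_of_int \<lfloor>Re z\<rfloor> = z" if "z \<in> \<int>" for z
    using that by (auto elim!: Ints_cases)
  thus "map_poly of_int (map_poly (\<lambda>z. \<lfloor>Re z\<rfloor>) (cyclotomic_complex n)) = cyclotomic_complex n"
    using cyclotomic_complex_Ints(1)[OF assms] by (intro poly_eqI) (simp add: coeff_map_poly)
next
  fix P :: "int poly"
  assume P: "map_poly of_int P = cyclotomic_complex n"
  show "P = map_poly (\<lambda>z. \<lfloor>Re z\<rfloor>) (cyclotomic_complex n)"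
    unfolding P[symmetric] by (intro poly_eqI) (simp add: coeff_map_poly)
qed

section \<open>Degree and palindromic symmetry\<close>

lemma degree_cyclotomic_complex: "degree (cyclotomic_complex n) = totient n"
  unfolding cyclotomic_complex_def totient_def by (subst degree_prod_eq_sum_degree) auto

text \<open>On the primitive roots of unity this is inversion. For n > 1 no totative equals n, so n
  - k stays positive.\<close>

lemma bij_betw_totatives_minus:
  assumes "n > 1"
  shows "bij_betw (\<lambda>k. n - k) (totatives n) (totatives n)"
proof (rule bij_betwI[where g = "\<lambda>k. n - k"])
  have "n - k \<in> totatives n" if "k \<in> totatives n" for k
  proof -
    have "k < n" using that assms by (auto intro: totatives_less)
    moreover have "coprime (n - k) n"
      using that \<open>k < n\<close> gcd_diff2_nat[of k n]
      by (simp add: in_totatives_iff coprime_iff_gcd_eq_1 gcd.commute[of n])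
    ultimately show ?thesis by (auto simp: in_totatives_iff)
  qed
  thus "(\<lambda>k. n - k) \<in> totatives n \<rightarrow> totatives n" "(\<lambda>k. n - k) \<in> totatives n \<rightarrow> totatives n"
    by auto
qed (auto simp: in_totatives_iff)

text \<open>Reflection turns X - z into 1 - z X = -z (X - 1/z). Inversion permutes the primitive
  roots, so the product is reproduced up to the product of all -z, which has to be shown equal to
  1.\<close>

lemma reflect_poly_cyclotomic_complex:
  assumes "n > 2"
  shows "reflect_poly (cyclotomic_complex n) = cyclotomic_complex n"
proof -
  define z where "z = (\<lambda>k. cis (2 * pi * real k / real n))"
  have bij: "bij_betw (\<lambda>k. n - k) (totatives n) (totatives n)"
    using assms by (intro bij_betw_totatives_minus) auto
  have "even (totient n)"
    using assms by (rule totient_even)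
  have inv: "z k * z (n - k) = 1" if "k \<in> totatives n" for k
  proof -
    have "2 * pi * real k / real n + 2 * pi * real (n - k) / real n = 2 * pi"
      using that assms totatives_le[OF that] by (simp add: of_nat_diff field_simps)
    thus ?thesis by (simp add: z_def cis_mult)
  qed
  have "reflect_poly (cyclotomic_complex n) = (\<Prod>k\<in>totatives n. reflect_poly [:- z k, 1:])"
    unfolding cyclotomic_complex_def z_def by (rule reflect_poly_prod)
  also have "\<dots> = (\<Prod>k\<in>totatives n. smult (- z k) [:- z (n - k), 1:])"
  proof (intro prod.cong refl)
    fix k assume "k \<in> totatives n"
    have "z k \<noteq> 0" by (simp add: z_def)
    thus "reflect_poly [:- z k, 1:] = smult (- z k) [:- z (n - k), 1:]"
      using inv[OF \<open>k \<in> totatives n\<close>] by (simp add: reflect_poly_pCons)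
  qed
  also have "\<dots> = smult (\<Prod>k\<in>totatives n. - z k) (\<Prod>k\<in>totatives n. [:- z (n - k), 1:])"
    by (rule prod_smult)
  also have "(\<Prod>k\<in>totatives n. [:- z (n - k), 1:]) = cyclotomic_complex n"
    unfolding cyclotomic_complex_def z_def
    by (rule prod.reindex_bij_betw[OF bij])
  \<comment> \<open>The signs cancel because \<open>totient n\<close> is even. Pairing k with n - k
    shows that twice the sum of the totatives is n times \<open>totient n\<close>, so the product of
    the roots is (-1)^\<open>totient n\<close> = 1.\<close>
  also have "(\<Prod>k\<in>totatives n. - z k) = 1"
  proof -
    have "real (\<Sum>k\<in>totatives n. k) + real (\<Sum>k\<in>totatives n. n - k) = (\<Sum>k\<in>totatives n. real n)"
      unfolding of_nat_sum sum.distrib[symmetric]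
      by (intro sum.cong refl) (auto dest: totatives_le simp: of_nat_diff)
    moreover have "(\<Sum>k\<in>totatives n. n - k) = (\<Sum>k\<in>totatives n. k)"
      by (rule sum.reindex_bij_betw[OF bij])
    ultimately have S: "2 * real (\<Sum>k\<in>totatives n. k) = real (totient n) * real n"
      by (simp add: totient_def)
    have "(\<Prod>k\<in>totatives n. - z k) = (\<Prod>k\<in>totatives n. -1) * (\<Prod>k\<in>totatives n. z k)"
      unfolding prod.distrib[symmetric] by simp
    also have "(\<Prod>k\<in>totatives n. -1 :: complex) = 1"
      using \<open>even (totient n)\<close> by (simp add: totient_def)
    also have "(\<Prod>k\<in>totatives n. z k) = (\<Prod>k\<in>totatives n. cis (2 * pi / real n) ^ k)"
      by (intro prod.cong refl) (simp add: z_def DeMoivre mult_ac)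
    also have "\<dots> = cis (2 * pi / real n) ^ (\<Sum>k\<in>totatives n. k)"
      by (rule power_sum[symmetric])
    also have "\<dots> = cis (pi * real (totient n))"
    proof -
      have "real (\<Sum>k\<in>totatives n. k) * (2 * pi / real n) = pi * real (totient n)"
        using S assms by (simp add: field_simps)
      thus ?thesis by (simp add: DeMoivre)
    qed
    also have "\<dots> = cis pi ^ totient n"
      by (subst DeMoivre) (simp add: mult.commute)
    also have "\<dots> = 1"
      using \<open>even (totient n)\<close> by simp
    finally show ?thesis by simp
  qed
  finally show ?thesis by simp
qed

lemma cyclotomic_int_palindromic:
  assumes "n > 2" "i \<le> totient n"
  shows "coeff (cyclotomic_int n) (totient n - i) = coeff (cyclotomic_int n) i"
proof -
  have "coeff (cyclotomic_complex n) i = coeff (reflect_poly (cyclotomic_complex n)) i"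
    using assms by (simp add: reflect_poly_cyclotomic_complex)
  also have "\<dots> = coeff (cyclotomic_complex n) (totient n - i)"
    using assms by (simp add: coeff_reflect_poly degree_cyclotomic_complex)
  finally show ?thesis
    using assms by (simp flip: map_poly_cyclotomic_int add: coeff_map_poly)
qed

text \<open>Serves to write an evaluation of \<open>cyclotomic n\<close> as a sum with indices up to
  \<open>totient n\<close>, the exponent used for homogenising.\<close>

lemma degree_cyclotomic_le:
  assumes "n > 0"
  shows "degree (cyclotomic n) \<le> totient n"
proof -
  have "coeff (cyclotomic_int n) i = 0" if "i > totient n" for i
  proof -
    have "complex_of_int (coeff (cyclotomic_int n) i) = coeff (cyclotomic_complex n) i"
      using assms by (simp flip: map_poly_cyclotomic_int add: coeff_map_poly)
    also have "\<dots> = 0"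
      using that by (simp add: coeff_eq_0 degree_cyclotomic_complex)
    finally show ?thesis by simp
  qed
  thus ?thesis
    by (intro degree_le) (simp add: cyclotomic_def coeff_map_poly)
qed

section \<open>Polynomials in \<open>B\<^sup>2\<close> and \<open>C\<close>\<close>

abbreviation even_B :: "'a::field poly poly set" where
  "even_B \<equiv> subalgebra_gen {var_B ^ 2, var_C}"

lemma subalgebra_gen_of_int: "of_int k \<in> subalgebra_gen S"
  using subalgebra_gen.const[of "of_int k" S] by (simp add: const_BC_def of_int_poly)

lemma subalgebra_gen_uminus: "x \<in> subalgebra_gen S \<Longrightarrow> - x \<in> subalgebra_gen S"
  using subalgebra_gen.mult[OF subalgebra_gen_of_int[of "-1"]] by fastforce

lemma subalgebra_gen_diff:
  "x \<in> subalgebra_gen S \<Longrightarrow> y \<in> subalgebra_gen S \<Longrightarrow> x - y \<in> subalgebra_gen S"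
  using subalgebra_gen.add[OF _ subalgebra_gen_uminus] by fastforce

lemma subalgebra_gen_power: "x \<in> subalgebra_gen S \<Longrightarrow> x ^ k \<in> subalgebra_gen S"
  using subalgebra_gen_of_int[of 1 S] by (induction k) (auto intro: subalgebra_gen.mult)

lemma subalgebra_gen_sum:
  "(\<And>x. x \<in> A \<Longrightarrow> f x \<in> subalgebra_gen S) \<Longrightarrow> sum f A \<in> subalgebra_gen S"
  using subalgebra_gen_of_int[of 0 S]
  by (induction A rule: infinite_finite_induct) (auto intro: subalgebra_gen.add)

lemmas subalgebra_gen_intros =
  subalgebra_gen_of_int subalgebra_gen_uminus subalgebra_gen_diff subalgebra_gen_power
  subalgebra_gen_sum subalgebra_gen.add subalgebra_gen.mult

section \<open>Lucas polynomials and even power sums\<close>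

lemma var_in_even_B: "var_B ^ 2 \<in> even_B" "var_C \<in> even_B"
  by (auto intro: subalgebra_gen.gen)

text \<open>Each step of the recurrence switches the parity in B, so both parities are handled in
  one induction: the factor B carried by an even index meets the B of the recurrence and gives
  B^2.\<close>

lemma lucas_U_parity:
  "(lucas_U (Suc (2 * k)) :: 'a::field poly poly) \<in> even_B \<and>
   (\<exists>x\<in>even_B. (lucas_U (2 * k) :: 'a poly poly) = var_B * x)"
proof (induction k)
  case 0
  show ?case
    using subalgebra_gen_of_int[of 1] subalgebra_gen_of_int[of 0] by force
next
  case (Suc k)
  then obtain x where x: "x \<in> even_B" "(lucas_U (2 * k) :: 'a poly poly) = var_B * x" by blast
  \<comment> \<open>This is what remains of the recurrence for index 2 k + 2 once B is factored out
    of both terms.\<close>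
  let ?y = "- (lucas_U (Suc (2 * k)) :: 'a poly poly) - var_C * x"
  have y: "?y \<in> even_B"
    using Suc x by (intro subalgebra_gen_intros var_in_even_B) auto
  have even: "lucas_U (2 * Suc k) = var_B * ?y"
  proof -
    have "lucas_U (2 * Suc k) = - var_B * lucas_U (Suc (2 * k)) - var_C * (var_B * x)"
      by (simp add: x)
    also have "\<dots> = var_B * ?y"
      by (simp add: algebra_simps)
    finally show ?thesis .
  qed
  have "lucas_U (Suc (2 * Suc k)) = - var_B * lucas_U (2 * Suc k) - var_C * lucas_U (Suc (2 * k))"
    using lucas_U.simps(3)[of "Suc (2 * k)"] by (simp del: lucas_U.simps)
  also have "\<dots> = - (var_B ^ 2 * ?y) - var_C * lucas_U (Suc (2 * k))"
    unfolding even by (simp add: power2_eq_square mult.assoc)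
  also have "\<dots> \<in> even_B"
    using Suc x by (intro subalgebra_gen_diff subalgebra_gen_uminus subalgebra_gen.mult var_in_even_B)
      auto
  finally show ?case using even y by blast
qed

text \<open>These are the power sums \<alpha>^(2 k) + \<beta>^(2 k): the squares \<alpha>^2 and
  \<beta>^2 have sum B^2 - 2 C and product C^2, which gives the recurrence. No odd power of B ever
  enters.\<close>

fun even_lucas_V :: "nat \<Rightarrow> 'a::field poly poly" where
  "even_lucas_V 0 = 2"
| "even_lucas_V (Suc 0) = var_B ^ 2 - 2 * var_C"
| "even_lucas_V (Suc (Suc k)) =
     (var_B ^ 2 - 2 * var_C) * even_lucas_V (Suc k) - var_C ^ 2 * even_lucas_V k"

lemma even_lucas_V_in_even_B: "even_lucas_V k \<in> even_B"
proof -
  have "2 \<in> even_B" using subalgebra_gen_of_int[of 2] by simp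
  thus ?thesis
    by (induction k rule: even_lucas_V.induct)
       (auto intro!: subalgebra_gen_diff subalgebra_gen.mult subalgebra_gen_power var_in_even_B)
qed

section \<open>The embedding into the algebraic closure\<close>

lemma embed_BC_simps [simp]:
  "embed_BC 0 = 0" "embed_BC 1 = 1"
  "embed_BC (p + q) = embed_BC p + embed_BC q" "embed_BC (p - q) = embed_BC p - embed_BC q"
  "embed_BC (- p) = - embed_BC p" "embed_BC (p * q) = embed_BC p * embed_BC q"
  by (simp_all add: embed_BC_def)

lemma embed_BC_power [simp]: "embed_BC (p ^ k) = embed_BC p ^ k"
  by (induction k) simp_all

lemma embed_BC_sum [simp]: "embed_BC (sum f A) = (\<Sum>x\<in>A. embed_BC (f x))"
  by (induction A rule: infinite_finite_induct) simp_all

lemma embed_BC_of_nat [simp]: "embed_BC (of_nat k) = of_nat k"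
  by (induction k) simp_all

lemma embed_BC_of_int [simp]: "embed_BC (of_int k) = of_int k"
  by (cases k rule: int_cases2) simp_all

lemma embed_BC_eq_iff [simp]: "embed_BC p = embed_BC q \<longleftrightarrow> p = q"
  by (simp add: embed_BC_def)

section \<open>The two roots of T^2 + B T + C\<close>

lemma embed_BC_var_C_nonzero: "embed_BC var_C \<noteq> 0"
  by (simp add: embed_BC_def var_C_def)

text \<open>Without a pair of roots the implication inside \<open>lucas_atom\<close> would be
  vacuous and would not determine the atom.\<close>

lemma roots_exist:
  "\<exists>\<alpha> \<beta> :: 'a::field BC_closure. [:embed_BC var_C, embed_BC var_B, 1:] = [:- \<alpha>, 1:] * [:- \<beta>, 1:]"
proof -
  obtain \<alpha> :: "'a BC_closure" where "poly [:embed_BC var_C, embed_BC var_B, 1:] \<alpha> = 0"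
    using alg_closed_imp_poly_has_root[of "[:embed_BC var_C, embed_BC var_B, 1:]"] by auto
  hence "embed_BC var_C = - \<alpha> * (embed_BC var_B + \<alpha>)"
    by (simp add: eq_neg_iff_add_eq_0 algebra_simps)
  \<comment> \<open>The second root is forced by the sum of the roots being -B.\<close>
  hence "[:embed_BC var_C, embed_BC var_B, 1:] = [:- \<alpha>, 1:] * [:- (- embed_BC var_B - \<alpha>), 1:]"
    by simp
  thus ?thesis by blast
qed

lemma roots_iff:
  "[:embed_BC var_C, embed_BC var_B, 1:] = [:- \<alpha>, 1:] * [:- \<beta>, 1:] \<longleftrightarrow>
     embed_BC var_B = - (\<alpha> + \<beta>) \<and> embed_BC var_C = \<alpha> * \<beta>"
  by auto

lemma embed_even_lucas_V:
  assumes "embed_BC var_B = - (\<alpha> + \<beta>)" "embed_BC var_C = \<alpha> * \<beta>"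
  shows "embed_BC (even_lucas_V k) = \<alpha> ^ (2 * k) + \<beta> ^ (2 * k)"
proof -
  have two: "embed_BC 2 = 2" using embed_BC_of_nat[of 2] by simp
  show ?thesis
    by (induction k rule: even_lucas_V.induct)
       (simp_all add: two assms power2_eq_square algebra_simps)
qed

section \<open>The Lucas atoms as explicit polynomials in B^2 and C\<close>

lemma sum_symmetric_pairs:
  fixes f :: "nat \<Rightarrow> 'a :: comm_monoid_add"
  shows "(\<Sum>i\<le>2 * m. f i) = f m + (\<Sum>i<m. f i + f (2 * m - i))"
proof -
  have "{..2 * m} = insert m ({..<m} \<union> {m<..2 * m})" by auto
  moreover have "sum f ({..<m} \<union> {m<..2 * m}) = sum f {..<m} + sum f {m<..2 * m}"
    by (intro sum.union_disjoint) auto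
  moreover have "sum f {m<..2 * m} = (\<Sum>i<m. f (2 * m - i))"
    by (rule sum.reindex_bij_witness[of _ "\<lambda>i. 2 * m - i" "\<lambda>i. 2 * m - i"]) auto
  ultimately show ?thesis by (simp add: sum.distrib)
qed

text \<open>The candidate for \<open>lucas_atom n\<close>. For n > 2 the halving in \<open>m\<close>
  is exact, since \<open>totient n\<close> is then even.\<close>

definition atom_poly :: "nat \<Rightarrow> 'a::field poly poly" where
  "atom_poly n = (let c = (\<lambda>i. of_int (coeff (cyclotomic_int n) i)); m = totient n div 2 in
     c m * var_C ^ m + (\<Sum>i<m. c i * (var_C ^ i * even_lucas_V (m - i))))"

lemma atom_poly_in_even_B: "atom_poly n \<in> even_B"
  unfolding atom_poly_def Let_def
  by (intro subalgebra_gen_intros even_lucas_V_in_even_B var_in_even_B)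

lemma embed_atom_poly:
  assumes n: "n > 2"
    and B: "embed_BC var_B = - (\<alpha> + \<beta>)" and C: "embed_BC var_C = \<alpha> * \<beta>"
  shows "embed_BC (atom_poly n) = cyclotomic_hom n \<alpha> \<beta>"
proof -
  define c :: "nat \<Rightarrow> 'a BC_closure" where "c = (\<lambda>i. of_int (coeff (cyclotomic_int n) i))"
  define m where "m = totient n div 2"
  have d: "totient n = 2 * m"
    using totient_even[OF n] by (simp add: m_def)
  have pal: "c (2 * m - i) = c i" if "i \<le> 2 * m" for i
    using cyclotomic_int_palindromic[OF n, of i] that by (simp add: c_def d)
  \<comment> \<open>Since \<alpha> \<beta> = C is nonzero, \<alpha> / \<beta> is a genuine
    quotient.\<close>
  have "\<beta> \<noteq> 0" using embed_BC_var_C_nonzero C by auto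
  let ?p = "map_poly (\<lambda>c. embed_BC (const_BC c)) (cyclotomic n :: 'a poly)"
  have emb: "embed_BC (const_BC (of_int k)) = of_int k" for k
    using embed_BC_of_int[of k] by (simp add: const_BC_def of_int_poly)
  have coeff: "coeff ?p i = c i" for i
    unfolding cyclotomic_def c_def
    by (subst coeff_map_poly) (use emb[of 0] in \<open>auto simp: coeff_map_poly emb\<close>)
  have "degree ?p \<le> 2 * m"
    using degree_cyclotomic_le[of n, where 'a = 'a] n emb[of 0] d
    by (intro degree_le) (auto simp: coeff_map_poly coeff_eq_0 const_BC_def)
  \<comment> \<open>The sum up to the degree is extended to 2 m by zero coefficients.\<close>
  hence "cyclotomic_hom n \<alpha> \<beta> = \<beta> ^ (2 * m) * (\<Sum>i\<le>2 * m. c i * (\<alpha> / \<beta>) ^ i)"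
    unfolding cyclotomic_hom_def d poly_altdef coeff[symmetric]
    by (intro arg_cong[of _ _ "\<lambda>x. _ * x"] sum.mono_neutral_left) (auto simp: coeff_eq_0)
  also have "\<dots> = (\<Sum>i\<le>2 * m. c i * (\<alpha> ^ i * \<beta> ^ (2 * m - i)))"
    unfolding sum_distrib_left using \<open>\<beta> \<noteq> 0\<close>
    by (intro sum.cong refl) (simp add: power_divide power_diff)
  \<comment> \<open>The middle term stays alone. Doubling the whole sum instead would call for a
    division by 2, impossible in characteristic 2.\<close>
  also have "\<dots> = c m * (\<alpha> ^ m * \<beta> ^ (2 * m - m)) +
      (\<Sum>i<m. c i * (\<alpha> ^ i * \<beta> ^ (2 * m - i)) +
        c (2 * m - i) * (\<alpha> ^ (2 * m - i) * \<beta> ^ (2 * m - (2 * m - i))))"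
    by (rule sum_symmetric_pairs)
  also have "\<dots> = c m * (\<alpha> * \<beta>) ^ m +
      (\<Sum>i<m. c i * ((\<alpha> * \<beta>) ^ i * (\<alpha> ^ (2 * (m - i)) + \<beta> ^ (2 * (m - i)))))"
  proof (intro arg_cong2[of _ _ _ _ "(+)"] sum.cong refl)
    show "c m * (\<alpha> ^ m * \<beta> ^ (2 * m - m)) = c m * (\<alpha> * \<beta>) ^ m"
      by (simp add: power_mult_distrib)
  next
    fix i assume "i \<in> {..<m}"
    \<comment> \<open>Taking (\<alpha> \<beta>)^i out of a pair leaves the exponent 2 (m - i), which
      is even; so only even power sums occur.\<close>
    then have "2 * m - i = i + 2 * (m - i)" "2 * m - (2 * m - i) = i" "c (2 * m - i) = c i"
      by (auto intro: pal)
    then show "c i * (\<alpha> ^ i * \<beta> ^ (2 * m - i)) +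
        c (2 * m - i) * (\<alpha> ^ (2 * m - i) * \<beta> ^ (2 * m - (2 * m - i))) =
        c i * ((\<alpha> * \<beta>) ^ i * (\<alpha> ^ (2 * (m - i)) + \<beta> ^ (2 * (m - i))))"
      by (simp only: power_add power_mult_distrib) (simp add: algebra_simps)
  qed
  also have "\<dots> = embed_BC (atom_poly n)"
    by (simp add: atom_poly_def Let_def embed_even_lucas_V[OF B C] C flip: c_def m_def)
       (simp add: c_def)
  finally show ?thesis ..
qed

text \<open>\<open>embed_atom_poly\<close> covers every ordered pair of roots. For uniqueness, one
  such pair fixes the embedded value, and \<open>embed_BC\<close> is injective.\<close>

lemma lucas_atom_eq_atom_poly:
  assumes "n > 2"
  shows "lucas_atom n = atom_poly n"
  unfolding lucas_atom_def
proof (rule the_equality)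
  show "\<forall>\<alpha> \<beta>. [:embed_BC var_C, embed_BC var_B, 1:] = [:- \<alpha>, 1:] * [:- \<beta>, 1:] \<longrightarrow>
      embed_BC (atom_poly n) = cyclotomic_hom n \<alpha> \<beta>"
    unfolding roots_iff using embed_atom_poly[OF assms] by blast
next
  fix L :: "'a poly poly"
  assume L: "\<forall>\<alpha> \<beta>. [:embed_BC var_C, embed_BC var_B, 1:] = [:- \<alpha>, 1:] * [:- \<beta>, 1:] \<longrightarrow>
      embed_BC L = cyclotomic_hom n \<alpha> \<beta>"
  obtain \<alpha> \<beta> :: "'a BC_closure"
    where "[:embed_BC var_C, embed_BC var_B, 1:] = [:- \<alpha>, 1:] * [:- \<beta>, 1:]"
    using roots_exist by blast
  with L have "embed_BC L = embed_BC (atom_poly n)"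
    using embed_atom_poly[OF assms] unfolding roots_iff by metis
  thus "L = atom_poly n" by simp
qed

theorem lemma5p8:
  fixes q n :: nat
  assumes "\<exists>k\<ge>1. q = 2 ^ k"
    and "card (UNIV :: 'a::{field,finite} set) = q"
    and "odd n" and "n > 1"
  shows "(lucas_U n :: 'a poly poly) \<in> subalgebra_gen {var_B ^ 2, var_C}
       \<and> (lucas_atom n :: 'a poly poly) \<in> subalgebra_gen {var_B ^ 2, var_C}"
proof
  obtain k where "n = Suc (2 * k)"
    using \<open>odd n\<close> by (metis oddE Suc_eq_plus1)
  thus "(lucas_U n :: 'a poly poly) \<in> even_B"
    using lucas_U_parity by blast
  \<comment> \<open>Oddness excludes n = 2, whose totient 1 is odd and leaves no middle term for the
    pairing.\<close>
  have "n > 2"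
    using \<open>odd n\<close> \<open>n > 1\<close> by (cases "n = 2") auto
  thus "(lucas_atom n :: 'a poly poly) \<in> even_B"
    by (simp add: lucas_atom_eq_atom_poly atom_poly_in_even_B)
qed

end
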